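(* Let $\mathcal{H}$ be a real Hilbert space with inner product $\langle\cdot,\cdot\rangle$, let $\eta\colon\mathcal{H}\to\mathbb{R}$ be a smooth convex function, and consider the ODE $u'(t)=f(t,u(t))$ with $f\colon[0,T]\times\mathcal{H}\to\mathcal{H}$. Let a (explicit or implicit) $s$-stage Runge--Kutta method with coefficients $A=(a_{ij})\in\mathbb{R}^{s\times s}$, $b,c\in\mathbb{R}^s$ be given. Given $u^n\in\mathcal{H}$, $t_n$, and $\Delta t>0$, let $y_1,\dots,y_s$ satisfy $y_i=u^n+\Delta t\sum_{j=1}^s a_{ij}f(t_n+c_j\Delta t,y_j)$, put $f_i=f(t_n+c_i\Delta t,y_i)$, let $\gamma_n\in\mathbb{R}$ be a root of $$r(\gamma)=\eta\Bigl(u^n+\gamma\Delta t\sum_{i=1}^s b_if_i\Bigr)-\eta(u^n)-\gamma\Delta t\sum_{i=1}^s b_i\langle\eta'(y_i),f_i\rangle ,$$ and define $u^{n+1}_\gamma=u^n+\gamma_n\Delta t\sum_{i=1}^s b_if_i$. Then: (1) The resulting method is conservative: if $\langle\eta'(u),f(t,u)\rangle=0$ for all $u\in\mathcal{H}$, $t\in[0,T]$, then $\eta(u^{n+1}_\gamma)=\eta(u^n)$. (2) If the weights satisfy $b_i\ge 0$ for all $i$ and $\gamma_n\ge 0$, then the method is dissipation preserving: if $\langle\eta'(u),f(t,u)\rangle\le 0$ for all $u\in\mathcal{H}$, $t\in[0,T]$, then $\eta(u^{n+1}_\gamma)\le\eta(u^n)$.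
   Context: $\eta'(u)$ denotes the gradient (Fréchet derivative identified with an element of $\mathcal{H}$) of $\eta$ at $u$. The step is assumed to be such that all stage times $t_n+c_i\Delta t$ lie in $[0,T]$. *)

theory Defs
  imports "HOL-Analysis.Analysis"
begin

text \<open>
  A \<open>k\<close>-linear form is represented by its action on argument lists of length \<open>k\<close>; its values on
  lists of any other length are irrelevant.
\<close>

definition bounded_multilinear_form :: "nat \<Rightarrow> ('a::real_normed_vector list \<Rightarrow> real) \<Rightarrow> bool" where
  "bounded_multilinear_form k M \<longleftrightarrow>
     (\<forall>vs. length vs = k \<longrightarrow> (\<forall>i<k. linear (\<lambda>v. M (vs[i := v])))) \<and>
     (\<exists>C. \<forall>vs. length vs = k \<longrightarrow> \<bar>M vs\<bar> \<le> C * (\<Prod>v\<leftarrow>vs. norm v))"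

text \<open>
  Infinitely often Frechet differentiable: \<open>D k x\<close> is the \<open>k\<close>-th derivative at \<open>x\<close>, and \<open>D (Suc k)\<close>
  is the Frechet derivative of \<open>D k\<close> as a map into the space of bounded \<open>k\<close>-linear forms with the
  operator norm. The estimate below, uniform in \<open>vs\<close>, says that the norm of the remainder is at
  most \<open>e * norm h\<close>.
\<close>

definition smooth :: "('a::real_normed_vector \<Rightarrow> real) \<Rightarrow> bool" where
  "smooth g \<longleftrightarrow> (\<exists>D :: nat \<Rightarrow> 'a \<Rightarrow> 'a list \<Rightarrow> real.
     (\<forall>x. D 0 x [] = g x) \<and>
     (\<forall>k x. bounded_multilinear_form k (D k x)) \<and>
     (\<forall>k x. \<forall>e>0. \<exists>d>0. \<forall>h. norm h < d \<longrightarrow>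
        (\<forall>vs. length vs = k \<longrightarrow>
           \<bar>D k (x + h) vs - D k x vs - D (Suc k) x (h # vs)\<bar>
             \<le> e * norm h * (\<Prod>v\<leftarrow>vs. norm v))))"

definition gradient :: "('a::real_inner \<Rightarrow> real) \<Rightarrow> 'a \<Rightarrow> 'a" where
  "gradient g u = (THE D. GDERIV g u :> D)"

text \<open>
  The definite description is justified: by the Riesz representation theorem, on a Hilbert space
  every Frechet differentiable function has a gradient.
\<close>

lemma smooth_has_derivative:
  assumes "smooth g"
  shows "\<exists>g'. (g has_derivative g') (at x)"
proof -
  obtain D :: "nat \<Rightarrow> 'a \<Rightarrow> 'a list \<Rightarrow> real"
    where D0: "\<And>x. D 0 x [] = g x"
      and M: "\<And>k x. bounded_multilinear_form k (D k x)"
      and E: "\<And>k x e. e > 0 \<Longrightarrow> \<exists>d>0. \<forall>h. norm h < d \<longrightarrow> (\<forall>vs. length vs = k \<longrightarrow>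
           \<bar>D k (x + h) vs - D k x vs - D (Suc k) x (h # vs)\<bar> \<le> e * norm h * (\<Prod>v\<leftarrow>vs. norm v))"
    using assms unfolding smooth_def by metis
  let ?L = "\<lambda>h. D 1 x [h]"
  have lin: "linear ?L"
    using M[of 1 x] unfolding bounded_multilinear_form_def
    by (auto dest!: spec[of _ "[0]"])
  obtain C where C: "\<And>vs. length vs = 1 \<Longrightarrow> \<bar>D 1 x vs\<bar> \<le> C * (\<Prod>v\<leftarrow>vs. norm v)"
    using M[of 1 x] unfolding bounded_multilinear_form_def by blast
  have "bounded_linear ?L"
    unfolding bounded_linear_def bounded_linear_axioms_def
    using lin C[of "[_]"] by (auto simp: mult.commute intro!: exI[of _ C])
  moreover have "\<exists>d>0. \<forall>y. norm (y - x) < d \<longrightarrow> norm (g y - g x - ?L (y - x)) \<le> e * norm (y - x)"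
    if e: "e > 0" for e
  proof -
    obtain d where d: "d > 0" "\<And>h. norm h < d \<Longrightarrow> \<bar>D 0 (x + h) [] - D 0 x [] - D (Suc 0) x [h]\<bar> \<le> e * norm h"
      using E[OF e, where k = 0 and x = x] by auto
    show ?thesis
      using d(1) d(2)[of "_ - x"] by (intro exI[of _ d]) (auto simp: D0)
  qed
  ultimately show ?thesis
    unfolding has_derivative_at_alt by blast
qed

lemma riesz_representation:
  fixes \<phi> :: "'a::{real_inner, banach} \<Rightarrow> real"
  assumes "bounded_linear \<phi>"
  shows "\<exists>D. \<forall>h. \<phi> h = inner h D"
proof -
  interpret bounded_linear \<phi> by fact
  define q where "q x = inner x x / 2 - \<phi> x" for x
  obtain K where K: "\<And>x. norm (\<phi> x) \<le> norm x * K"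
    using bounded by blast
  have lower: "- (K\<^sup>2 / 2) \<le> q x" for x
  proof -
    have "0 \<le> (norm x - K)\<^sup>2" by simp
    then show ?thesis
      using K[of x] unfolding q_def power2_norm_eq_inner[symmetric]
      by (simp add: power2_eq_square algebra_simps)
  qed
  have bdd: "bdd_below (range q)"
    using lower by (intro bdd_belowI[of _ "- (K\<^sup>2 / 2)"]) auto
  define m where "m = Inf (range q)"
  have m: "m \<le> q x" for x
    unfolding m_def using bdd by (simp add: cINF_lower)
  have "\<exists>x. q x < m + inverse (real (Suc n))" for n
  proof -
    have "m < m + inverse (real (Suc n))" by simp
    then show ?thesis
      unfolding m_def using cINF_less_iff[OF UNIV_not_empty bdd] by (simp only:) blast
  qed
  then obtain X where X: "\<And>n. q (X n) < m + inverse (real (Suc n))" by metis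
  have par: "(norm (x - y))\<^sup>2 / 4 = q x + q y - 2 * q ((1/2) *\<^sub>R (x + y))" for x y
    unfolding q_def power2_norm_eq_inner scaleR add
    by (simp add: inner_add inner_diff inner_commute field_simps)
  have close: "(norm (X i - X j))\<^sup>2 < 4 * inverse (real (Suc i)) + 4 * inverse (real (Suc j))" for i j
    using par[of "X i" "X j"] X[of i] X[of j] m[of "(1/2) *\<^sub>R (X i + X j)"] by linarith
  have "Cauchy X"
  proof (rule metric_CauchyI)
    fix e :: real assume e: "e > 0"
    then obtain N where N: "inverse (real (Suc N)) < e\<^sup>2 / 8"
      using reals_Archimedean[of "e\<^sup>2 / 8"] by auto
    have "dist (X i) (X j) < e" if "N \<le> i" "N \<le> j" for i j
    proof -
      have "inverse (real (Suc i)) \<le> inverse (real (Suc N))"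
        "inverse (real (Suc j)) \<le> inverse (real (Suc N))"
        using that by (auto intro!: le_imp_inverse_le)
      then have "(norm (X i - X j))\<^sup>2 < e\<^sup>2"
        using close[of i j] N by linarith
      then show ?thesis
        unfolding dist_norm using e by (simp add: power_less_imp_less_base)
    qed
    then show "\<exists>N. \<forall>i\<ge>N. \<forall>j\<ge>N. dist (X i) (X j) < e" by blast
  qed
  then obtain L where L: "X \<longlonglongrightarrow> L"
    using Cauchy_convergent convergent_def by blast
  have "(\<lambda>n. q (X n)) \<longlonglongrightarrow> q L"
    unfolding q_def by (intro tendsto_intros tendsto L) auto
  moreover have "(\<lambda>n. m + inverse (real (Suc n))) \<longlonglongrightarrow> m + 0"
    by (intro tendsto_intros LIMSEQ_inverse_real_of_nat)
  ultimately have "q L \<le> m + 0"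
    by (rule LIMSEQ_le) (use X in \<open>auto intro: less_imp_le\<close>)
  then have qL: "q L \<le> q x" for x
    using m[of x] by simp
  have "\<phi> h = inner h L" for h
  proof (rule ccontr)
    assume ne: "\<phi> h \<noteq> inner h L"
    define a where "a = inner h L - \<phi> h"
    define t where "t = - a / (inner h h)"
    have a: "a \<noteq> 0" using ne by (simp add: a_def)
    have "h \<noteq> 0" using ne zero by auto
    then have hh: "inner h h > 0" by simp
    have "q (L + t *\<^sub>R h) = q L + t * a + t\<^sup>2 * inner h h / 2"
      unfolding q_def a_def add scaleR
      by (simp add: inner_add inner_commute power2_eq_square field_simps)
    also have "\<dots> = q L - a\<^sup>2 / (2 * inner h h)"
      using hh by (simp add: t_def power2_eq_square field_simps)
    also have "\<dots> < q L" using a hh by simp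
    finally show False using qL[of "L + t *\<^sub>R h"] by simp
  qed
  then show ?thesis by blast
qed

lemma smooth_GDERIV_gradient:
  fixes g :: "'a::{real_inner, banach} \<Rightarrow> real"
  assumes "smooth g"
  shows "GDERIV g u :> gradient g u"
proof -
  obtain g' where g': "(g has_derivative g') (at u)"
    using smooth_has_derivative[OF assms] by blast
  then obtain D where "\<And>h. g' h = inner h D"
    using riesz_representation[of g'] has_derivative_bounded_linear by blast
  then have "GDERIV g u :> D"
    using g' unfolding gderiv_def by (metis ext)
  moreover have "D' = D" if "GDERIV g u :> D'" for D'
  proof -
    have "(\<lambda>h. inner h D') = (\<lambda>h. inner h D)"
      using that \<open>GDERIV g u :> D\<close> unfolding gderiv_def by (rule has_derivative_unique)
    then have "inner (D' - D) (D' - D) = 0"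
      by (metis inner_diff_right right_minus_eq)
    then show ?thesis by simp
  qed
  ultimately show ?thesis
    unfolding gradient_def by (rule theI)
qed

end

theory Submission
  imports Defs
begin

text \<open>The relaxation parameter is chosen so that the entropy change over the step is known
  exactly. Being a root of \<open>r\<close> means that
  \<open>\<eta> u\<^sub>\<gamma> - \<eta> u\<^sub>n\<close> equals
  \<open>\<gamma>\<^sub>n * \<Delta>t\<close> times the \<open>b\<close>-weighted sum
  \<open>S\<close> of the entropy production rates
  \<open>inner (gradient \<eta> (y i)) (F i)\<close> at the stages. Each rate is the quantity
  controlled by the assumption on \<open>f\<close>, sampled at one stage. If all rates vanish, so
  does \<open>S\<close>; if they are nonpositive, nonnegative weights and a nonnegative factor carry
  that sign over to the entropy change.\<close>

theorem theorem2p2: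
  fixes \<eta> :: "'h::{real_inner, banach} \<Rightarrow> real"
    and f :: "real \<Rightarrow> 'h \<Rightarrow> 'h"
    and T :: real
    and A :: "real ^ 's ^ 's"
    and b c :: "real ^ 's"
    and u\<^sub>n u\<^sub>\<gamma> :: 'h
    and t\<^sub>n \<Delta>t \<gamma>\<^sub>n :: real
    and y F :: "'s \<Rightarrow> 'h"
    and r :: "real \<Rightarrow> real"
  assumes smooth: "smooth \<eta>"
    and convex: "convex_on UNIV \<eta>"
    and step_pos: "\<Delta>t > 0"
    and stage_times: "\<And>i. t\<^sub>n + c $ i * \<Delta>t \<in> {0..T}"
    and stages: "\<And>i. y i = u\<^sub>n + \<Delta>t *\<^sub>R (\<Sum>j\<in>UNIV. (A $ i $ j) *\<^sub>R f (t\<^sub>n + c $ j * \<Delta>t) (y j))"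
    and slopes: "\<And>i. F i = f (t\<^sub>n + c $ i * \<Delta>t) (y i)"
    and r_eq: "\<And>\<gamma>. r \<gamma> = \<eta> (u\<^sub>n + (\<gamma> * \<Delta>t) *\<^sub>R (\<Sum>i\<in>UNIV. (b $ i) *\<^sub>R F i)) - \<eta> u\<^sub>n
                 - \<gamma> * \<Delta>t * (\<Sum>i\<in>UNIV. b $ i * inner (gradient \<eta> (y i)) (F i))"
    and root: "r \<gamma>\<^sub>n = 0"
    and update: "u\<^sub>\<gamma> = u\<^sub>n + (\<gamma>\<^sub>n * \<Delta>t) *\<^sub>R (\<Sum>i\<in>UNIV. (b $ i) *\<^sub>R F i)"
  shows "((\<forall>u. \<forall>t\<in>{0..T}. inner (gradient \<eta> u) (f t u) = 0) \<longrightarrow> \<eta> u\<^sub>\<gamma> = \<eta> u\<^sub>n) \<and>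
         ((\<forall>i. 0 \<le> b $ i) \<and> 0 \<le> \<gamma>\<^sub>n \<longrightarrow>
           (\<forall>u. \<forall>t\<in>{0..T}. inner (gradient \<eta> u) (f t u) \<le> 0) \<longrightarrow> \<eta> u\<^sub>\<gamma> \<le> \<eta> u\<^sub>n)"
proof -
  define S where "S = (\<Sum>i\<in>UNIV. b $ i * inner (gradient \<eta> (y i)) (F i))"
  \<comment> \<open>Exact entropy balance: at \<open>\<gamma>\<^sub>n\<close> the argument of
    \<open>\<eta>\<close> in \<open>r_eq\<close> is the update \<open>u\<^sub>\<gamma>\<close>
    itself.\<close>
  have change: "\<eta> u\<^sub>\<gamma> - \<eta> u\<^sub>n = \<gamma>\<^sub>n * \<Delta>t * S"
    using r_eq[of \<gamma>\<^sub>n] root update by (simp add: S_def)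
  have conservative: "\<eta> u\<^sub>\<gamma> = \<eta> u\<^sub>n"
    if "\<forall>u. \<forall>t\<in>{0..T}. inner (gradient \<eta> u) (f t u) = 0"
  proof -
    have "inner (gradient \<eta> (y i)) (F i) = 0" for i
      \<comment> \<open>The pointwise assumption is instantiated at the state \<open>y i\<close> and
        the stage time, which \<open>stage_times\<close> places in \<open>{0..T}\<close>.\<close>
      using that stage_times[of i] unfolding slopes by blast
    then have "S = 0"
      by (simp add: S_def)
    then show ?thesis
      using change by simp
  qed
  have dissipative: "\<eta> u\<^sub>\<gamma> \<le> \<eta> u\<^sub>n"
    if "\<forall>i. 0 \<le> b $ i" "0 \<le> \<gamma>\<^sub>n"
      "\<forall>u. \<forall>t\<in>{0..T}. inner (gradient \<eta> u) (f t u) \<le> 0"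
  proof -
    have "inner (gradient \<eta> (y i)) (F i) \<le> 0" for i
      using that(3) stage_times[of i] unfolding slopes by blast
    \<comment> \<open>Each summand is a nonnegative weight times a nonpositive rate.\<close>
    then have "S \<le> 0"
      unfolding S_def using that(1) by (intro sum_nonpos) (simp add: mult_nonneg_nonpos)
    \<comment> \<open>A negative \<open>\<gamma>\<^sub>n\<close> would reverse the sign here,
      turning dissipation into growth whenever \<open>S < 0\<close>.\<close>
    then have "\<gamma>\<^sub>n * \<Delta>t * S \<le> 0"
      using that(2) step_pos by (simp add: mult_nonneg_nonpos)
    then show ?thesis
      using change by simp
  qed
  show ?thesis
    using conservative dissipative by blast
qed

end
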